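(* Let $K$ be a field of characteristic $2$, $A$ an associative commutative $K$-algebra with unit, and $D$ a nonzero derivation of $A$. Any filtered deformation of the graded Lie algebra $\mathsf{S}\otimes A+KD$ is isomorphic to the Lie algebra (on the same underlying vector space) with the following bracket, where $a,b\in A$: $$\begin{aligned} \{e\otimes a,e\otimes b\}&=\xi(ab)D\\ \{e\otimes a,h\otimes b\}&=e\otimes ab+f\otimes\big(abv+\xi(b)D(a)\big)\\ \{e\otimes a,f\otimes b\}&=h\otimes ab\\ \{h\otimes a,h\otimes b\}&=0\\ \{h\otimes a,f\otimes b\}&=f\otimes ab\\ \{f\otimes a,f\otimes b\}&=0\\ \{e\otimes a,D\}&=e\otimes D(a)+f\otimes aw\\ \{h\otimes a,D\}&=h\otimes D(a)\\ \{f\otimes a,D\}&=f\otimes D(a) \end{aligned}$$ for some $v,w\in A$ such that $D(v)=0$, and some $\xi\in\Xi_{D,0}$ such that $$\big(\xi(ab)c+\xi(ca)b+\xi(bc)a\big)w=0$$ for any $a,b,c\in A$.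
   Context: $\mathsf{S}$ is the $3$-dimensional simple Lie algebra over $K$ with basis $\{e,h,f\}$ and multiplication $[e,h]=e$, $[f,h]=f$, $[e,f]=h$. The Lie algebra $\mathsf{S}\otimes A+KD$ has underlying vector space $(\mathsf{S}\otimes A)\oplus KD$ and brackets $[x\otimes a,y\otimes b]=[x,y]\otimes ab$, $[x\otimes a,D]=x\otimes D(a)$. It is $\mathbb{Z}$-graded: weight $-1$: $e\otimes A$; weight $0$: $h\otimes A+KD$; weight $1$: $f\otimes A$. A filtered deformation of a graded Lie algebra $L$ is a filtered Lie algebra (with descending filtration) whose associated graded Lie algebra is isomorphic to $L$ as a graded Lie algebra. $A^{[2]}$ is the linear span of the squares of all elements of $A$. $\Xi_{D,0}$ is the space of linear maps $\xi:A\to K$ vanishing on $A^{[2]}$ and $D(A)$ and satisfying $\xi(a)D(b)+\xi(b)D(a)=0$ and $(\xi(a)b+\xi(b)a+\xi(ab)1)D(c)+(\xi(c)a+\xi(a)c+\xi(ca)1)D(b)+(\xi(b)c+\xi(c)b+\xi(bc)1)D(a)=0$ for all $a,b,c\in A$. *)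

theory Defs
  imports Complex_Main "HOL-Library.Set_Algebras" "HOL-Library.Product_Plus"
begin

section \<open>Commutative algebras and derivations\<close>

locale comm_algebra = vector_space scale
  for scale :: "'k::field \<Rightarrow> 'a::comm_ring_1 \<Rightarrow> 'a" +
  assumes scale_mult_left: "scale c (a * b) = scale c a * b"

locale derivation = comm_algebra scale + Vector_Spaces.linear scale scale D
  for scale :: "'k::field \<Rightarrow> 'a::comm_ring_1 \<Rightarrow> 'a" and D :: "'a \<Rightarrow> 'a" +
  assumes leibniz: "D (a * b) = D a * b + a * D b"

definition square_span :: "('k::field \<Rightarrow> 'a::comm_ring_1 \<Rightarrow> 'a) \<Rightarrow> 'a set" where
  "square_span scale = module.span scale (range (\<lambda>a. a\<^sup>2))"

definition Xi_D_0 :: "('k::field \<Rightarrow> 'a::comm_ring_1 \<Rightarrow> 'a) \<Rightarrow> ('a \<Rightarrow> 'a) \<Rightarrow> ('a \<Rightarrow> 'k) set" where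
  "Xi_D_0 scale D = {\<xi>. Vector_Spaces.linear scale (*) \<xi> \<and>
     (\<forall>a \<in> square_span scale. \<xi> a = 0) \<and>
     (\<forall>a \<in> range D. \<xi> a = 0) \<and>
     (\<forall>a b. scale (\<xi> a) (D b) + scale (\<xi> b) (D a) = 0) \<and>
     (\<forall>a b c.
        (scale (\<xi> a) b + scale (\<xi> b) a + scale (\<xi> (a * b)) 1) * D c +
        (scale (\<xi> c) a + scale (\<xi> a) c + scale (\<xi> (c * a)) 1) * D b +
        (scale (\<xi> b) c + scale (\<xi> c) b + scale (\<xi> (b * c)) 1) * D a = 0)}"

section \<open>Lie algebras, filtrations and associated graded Lie algebras\<close>

locale lie_algebra = vector_space scale
  for scale :: "'k::field \<Rightarrow> 'l::ab_group_add \<Rightarrow> 'l" and br :: "'l \<Rightarrow> 'l \<Rightarrow> 'l" +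
  assumes linear_left: "Vector_Spaces.linear scale scale (\<lambda>x. br x y)"
    and linear_right: "Vector_Spaces.linear scale scale (\<lambda>y. br x y)"
    and alternating: "br x x = 0"
    and jacobi: "br (br x y) z + br (br y z) x + br (br z x) y = 0"

definition lie_isomorphism ::
  "('k::field \<Rightarrow> 'l::ab_group_add \<Rightarrow> 'l) \<Rightarrow> ('l \<Rightarrow> 'l \<Rightarrow> 'l) \<Rightarrow>
   ('k \<Rightarrow> 'm::ab_group_add \<Rightarrow> 'm) \<Rightarrow> ('m \<Rightarrow> 'm \<Rightarrow> 'm) \<Rightarrow> ('l \<Rightarrow> 'm) \<Rightarrow> bool" where
  "lie_isomorphism scale br scale' br' \<phi> \<longleftrightarrow>
     Vector_Spaces.linear scale scale' \<phi> \<and> bij \<phi> \<and> (\<forall>x y. \<phi> (br x y) = br' (\<phi> x) (\<phi> y))"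

text \<open>
  A descending \<open>\<int>\<close>-indexed filtration. As usual it is exhaustive and separated; without these
  two conditions the associated graded algebra would not see \<open>\<Inter>i. F i\<close> or anything outside
  \<open>\<Union>i. F i\<close>.
\<close>

locale filtered_lie_algebra = lie_algebra scale br
  for scale :: "'k::field \<Rightarrow> 'l::ab_group_add \<Rightarrow> 'l" and br :: "'l \<Rightarrow> 'l \<Rightarrow> 'l" +
  fixes F :: "int \<Rightarrow> 'l set"
  assumes subspace_filtration: "subspace (F i)"
    and descending: "antimono F"
    and bracket_filtration: "x \<in> F i \<Longrightarrow> y \<in> F j \<Longrightarrow> br x y \<in> F (i + j)"
    and exhaustive: "(\<Union>i. F i) = UNIV"
    and separated: "(\<Inter>i. F i) = {0}"

text \<open>
  A graded Lie algebra \<open>\<Oplus>i. G i\<close> is given by the family of its homogeneous components together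
  with the linear structure on each \<open>G i\<close> and the brackets \<open>G i \<times> G j \<rightarrow> G (i + j)\<close>. The
  operations are only relevant on the carriers \<open>piece G i\<close>.
\<close>

record ('k, 'v) graded_lie =
  piece :: "int \<Rightarrow> 'v set"
  gadd :: "int \<Rightarrow> 'v \<Rightarrow> 'v \<Rightarrow> 'v"
  gscale :: "int \<Rightarrow> 'k \<Rightarrow> 'v \<Rightarrow> 'v"
  gbracket :: "int \<Rightarrow> int \<Rightarrow> 'v \<Rightarrow> 'v \<Rightarrow> 'v"

definition graded_lie_isomorphism ::
  "('k, 'v) graded_lie \<Rightarrow> ('k, 'w) graded_lie \<Rightarrow> (int \<Rightarrow> 'v \<Rightarrow> 'w) \<Rightarrow> bool" where
  "graded_lie_isomorphism G H \<phi> \<longleftrightarrow>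
     (\<forall>i. bij_betw (\<phi> i) (piece G i) (piece H i)) \<and>
     (\<forall>i. \<forall>x \<in> piece G i. \<forall>y \<in> piece G i.
        \<phi> i (gadd G i x y) = gadd H i (\<phi> i x) (\<phi> i y)) \<and>
     (\<forall>i c. \<forall>x \<in> piece G i. \<phi> i (gscale G i c x) = gscale H i c (\<phi> i x)) \<and>
     (\<forall>i j. \<forall>x \<in> piece G i. \<forall>y \<in> piece G j.
        \<phi> (i + j) (gbracket G i j x y) = gbracket H i j (\<phi> i x) (\<phi> j y))"

text \<open>
  The degree \<open>i\<close> component is the quotient space \<open>F i / F (i + 1)\<close>, its elements being cosets.
  The unions below are unions of equal cosets, see \<open>assoc_graded_ops\<close>.
\<close>

definition assoc_graded ::
  "('k::field \<Rightarrow> 'l::ab_group_add \<Rightarrow> 'l) \<Rightarrow> ('l \<Rightarrow> 'l \<Rightarrow> 'l) \<Rightarrow> (int \<Rightarrow> 'l set) \<Rightarrow>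
   ('k, 'l set) graded_lie" where
  "assoc_graded scale br F =
     \<lparr> piece = (\<lambda>i. {x +o F (i + 1) | x. x \<in> F i}),
       gadd = (\<lambda>i X Y. X + Y),
       gscale = (\<lambda>i c X. \<Union>x\<in>X. scale c x +o F (i + 1)),
       gbracket = (\<lambda>i j X Y. \<Union>x\<in>X. \<Union>y\<in>Y. br x y +o F (i + j + 1)) \<rparr>"

definition filtered_deformation ::
  "('k::field \<Rightarrow> 'l::ab_group_add \<Rightarrow> 'l) \<Rightarrow> ('l \<Rightarrow> 'l \<Rightarrow> 'l) \<Rightarrow> (int \<Rightarrow> 'l set) \<Rightarrow>
   ('k, 'v) graded_lie \<Rightarrow> bool" where
  "filtered_deformation scale br F G \<longleftrightarrow>
     filtered_lie_algebra scale br F \<and>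
     (\<exists>\<phi>. graded_lie_isomorphism (assoc_graded scale br F) G \<phi>)"

context filtered_lie_algebra
begin

lemma coset_eq_iff: "x +o F i = y +o F i \<longleftrightarrow> x - y \<in> F i"
proof
  assume eq: "x +o F i = y +o F i"
  have "x \<in> x +o F i"
    using subspace_0[OF subspace_filtration] by (force simp: elt_set_plus_def)
  then show "x - y \<in> F i" unfolding eq by (auto simp: elt_set_plus_def)
next
  have *: "x +o F i \<subseteq> y +o F i" if xy: "x - y \<in> F i" for x y
  proof
    fix z assume "z \<in> x +o F i"
    then obtain u where u: "u \<in> F i" "z = x + u" by (auto simp: elt_set_plus_def)
    have "z = y + ((x - y) + u)" using u by simp
    then show "z \<in> y +o F i"
      using subspace_add[OF subspace_filtration xy u(1)] unfolding elt_set_plus_def by blast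
  qed
  assume "x - y \<in> F i"
  moreover from this have "y - x \<in> F i"
    using subspace_neg[OF subspace_filtration] by fastforce
  ultimately show "x +o F i = y +o F i" using * by blast
qed

lemma bracket_add:
  "br (x + y) z = br x z + br y z" "br z (x + y) = br z x + br z y"
proof -
  interpret l: Vector_Spaces.linear scale scale "\<lambda>x. br x z" by (rule linear_left)
  interpret r: Vector_Spaces.linear scale scale "\<lambda>x. br z x" by (rule linear_right)
  show "br (x + y) z = br x z + br y z" "br z (x + y) = br z x + br z y"
    by (rule l.add) (rule r.add)
qed

lemma assoc_graded_ops:
  fixes i j
  defines "G \<equiv> assoc_graded scale br F"
  shows "gadd G i (x +o F (i + 1)) (y +o F (i + 1)) = (x + y) +o F (i + 1)"
    and "gscale G i c (x +o F (i + 1)) = scale c x +o F (i + 1)"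
    and "x \<in> F i \<Longrightarrow> y \<in> F j \<Longrightarrow>
      gbracket G i j (x +o F (i + 1)) (y +o F (j + 1)) = br x y +o F (i + j + 1)"
proof -
  note zero = subspace_0[OF subspace_filtration]
  have self: "z \<in> z +o F k" for z k
    using zero by (force simp: elt_set_plus_def)
  have un: "(\<Union>z\<in>X. h z) = C" if "z \<in> X" "\<And>z. z \<in> X \<Longrightarrow> h z = C"
    for z :: 'l and X C and h :: "'l \<Rightarrow> 'l set"
    using that by blast
  show "gadd G i (x +o F (i + 1)) (y +o F (i + 1)) = (x + y) +o F (i + 1)"
  proof -
    have "u \<in> F k + F k" if "u \<in> F k" for u k
      using set_plus_intro[OF that zero[of k]] by simp
    moreover have "F k + F k \<subseteq> F k" for k
      unfolding set_plus_def using subspace_add[OF subspace_filtration] by blast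
    ultimately have "F (i + 1) + F (i + 1) = F (i + 1)"
      by blast
    then show ?thesis
      by (simp add: G_def assoc_graded_def set_plus_rearrange)
  qed
  have "scale c x' +o F (i + 1) = scale c x +o F (i + 1)" if x': "x' \<in> x +o F (i + 1)" for x'
  proof -
    obtain u where "u \<in> F (i + 1)" "x' = x + u" using x' by (auto simp: elt_set_plus_def)
    then show ?thesis
      by (simp add: coset_eq_iff scale_right_distrib subspace_scale[OF subspace_filtration])
  qed
  then show "gscale G i c (x +o F (i + 1)) = scale c x +o F (i + 1)"
    unfolding G_def assoc_graded_def graded_lie.simps by (rule un[OF self])
  assume x: "x \<in> F i" and y: "y \<in> F j"
  have "br x' y' +o F (i + j + 1) = br x y +o F (i + j + 1)"
    if x': "x' \<in> x +o F (i + 1)" and y': "y' \<in> y +o F (j + 1)" for x' y'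
  proof -
    obtain u w where u: "u \<in> F (i + 1)" "x' = x + u" and w: "w \<in> F (j + 1)" "y' = y + w"
      using x' y' by (auto simp: elt_set_plus_def)
    have "F (j + 1) \<subseteq> F j" using descending by (simp add: antimonoD)
    then have "y' \<in> F j"
      using w y subspace_add[OF subspace_filtration] by blast
    then have "br u y' \<in> F (i + j + 1)" "br x w \<in> F (i + j + 1)"
      using bracket_filtration[OF u(1), of y' j] bracket_filtration[OF x w(1)]
      by (simp_all add: ac_simps)
    moreover have "br x' y' - br x y = br u y' + br x w"
      using u w by (simp add: bracket_add)
    ultimately show ?thesis
      using subspace_add[OF subspace_filtration] by (auto simp: coset_eq_iff)
  qed
  then show "gbracket G i j (x +o F (i + 1)) (y +o F (j + 1)) = br x y +o F (i + j + 1)"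
    unfolding G_def assoc_graded_def graded_lie.simps by (intro un[OF self])
qed

end

section \<open>The Lie algebra \<open>S \<otimes> A + K D\<close>\<close>

text \<open>
  The triple \<open>(x, y, z)\<close> stands for \<open>x e + y h + z f\<close>. The bracket is the alternating bilinear
  extension of \<open>[e, h] = e\<close>, \<open>[f, h] = f\<close>, \<open>[e, f] = h\<close>; it is stated over an arbitrary
  commutative ring, so that it gives \<open>S\<close> over \<open>K\<close> and \<open>S \<otimes> A\<close>, identified with
  triples over \<open>A\<close>, at once (see \<open>S_bracket_tensor\<close>).
\<close>

fun S_bracket :: "'r::comm_ring_1 \<times> 'r \<times> 'r \<Rightarrow> 'r \<times> 'r \<times> 'r \<Rightarrow> 'r \<times> 'r \<times> 'r" where
  "S_bracket (x, y, z) (x', y', z') = (x * y' - y * x', x * z' - z * x', z * y' - y * z')"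

definition S_e :: "'r::comm_ring_1 \<times> 'r \<times> 'r" where "S_e = (1, 0, 0)"
definition S_h :: "'r::comm_ring_1 \<times> 'r \<times> 'r" where "S_h = (0, 1, 0)"
definition S_f :: "'r::comm_ring_1 \<times> 'r \<times> 'r" where "S_f = (0, 0, 1)"

fun triple_scale :: "('k \<Rightarrow> 'a \<Rightarrow> 'a) \<Rightarrow> 'k \<Rightarrow> 'a \<times> 'a \<times> 'a \<Rightarrow> 'a \<times> 'a \<times> 'a" where
  "triple_scale scale c (x, y, z) = (scale c x, scale c y, scale c z)"

fun tensor_S :: "('k \<Rightarrow> 'a \<Rightarrow> 'a) \<Rightarrow> 'k \<times> 'k \<times> 'k \<Rightarrow> 'a \<Rightarrow> 'a \<times> 'a \<times> 'a" where
  "tensor_S scale (x, y, z) a = (scale x a, scale y a, scale z a)"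

fun triple_map :: "('a \<Rightarrow> 'a) \<Rightarrow> 'a \<times> 'a \<times> 'a \<Rightarrow> 'a \<times> 'a \<times> 'a" where
  "triple_map D (x, y, z) = (D x, D y, D z)"

type_synonym ('k, 'a) SAD = "('a \<times> 'a \<times> 'a) \<times> 'k"

fun SAD_scale :: "('k::field \<Rightarrow> 'a::comm_ring_1 \<Rightarrow> 'a) \<Rightarrow> 'k \<Rightarrow> ('k, 'a) SAD \<Rightarrow> ('k, 'a) SAD" where
  "SAD_scale scale c (u, s) = (triple_scale scale c u, c * s)"

fun SAD_bracket ::
  "('k::field \<Rightarrow> 'a::comm_ring_1 \<Rightarrow> 'a) \<Rightarrow> ('a \<Rightarrow> 'a) \<Rightarrow>
   ('k, 'a) SAD \<Rightarrow> ('k, 'a) SAD \<Rightarrow> ('k, 'a) SAD" where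
  "SAD_bracket scale D (u, s) (v, t) =
     (S_bracket u v + triple_scale scale t (triple_map D u) - triple_scale scale s (triple_map D v),
      0)"

definition tens :: "('k::field \<Rightarrow> 'a::comm_ring_1 \<Rightarrow> 'a) \<Rightarrow> 'k \<times> 'k \<times> 'k \<Rightarrow> 'a \<Rightarrow> ('k, 'a) SAD" where
  "tens scale x a = (tensor_S scale x a, 0)"

definition D_elt :: "('k::field, 'a::comm_ring_1) SAD" where
  "D_elt = (0, 1)"

definition SAD_piece :: "('k::field \<Rightarrow> 'a::comm_ring_1 \<Rightarrow> 'a) \<Rightarrow> int \<Rightarrow> ('k, 'a) SAD set" where
  "SAD_piece scale i =
     (if i = -1 then {tens scale S_e a | a. True}
      else if i = 0 then {tens scale S_h a + SAD_scale scale s D_elt | a s. True}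
      else if i = 1 then {tens scale S_f a | a. True}
      else {0})"

definition SAD_graded ::
  "('k::field \<Rightarrow> 'a::comm_ring_1 \<Rightarrow> 'a) \<Rightarrow> ('a \<Rightarrow> 'a) \<Rightarrow> ('k, ('k, 'a) SAD) graded_lie" where
  "SAD_graded scale D =
     \<lparr> piece = SAD_piece scale,
       gadd = (\<lambda>i. (+)),
       gscale = (\<lambda>i. SAD_scale scale),
       gbracket = (\<lambda>i j. SAD_bracket scale D) \<rparr>"

lemma (in comm_algebra) S_bracket_tensor:
  "S_bracket (tensor_S scale x a) (tensor_S scale y b) = tensor_S scale (S_bracket x y) (a * b)"
proof -
  have "scale c a * scale d b = scale (c * d) (a * b)" for c d
    by (metis mult.commute scale_mult_left scale_scale)
  then show ?thesis
    by (cases x; cases y) (simp add: scale_left_diff_distrib)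
qed

lemma (in derivation) SAD_bracket_tens:
  "SAD_bracket scale D (tens scale x a) (tens scale y b) = tens scale (S_bracket x y) (a * b)"
  "SAD_bracket scale D (tens scale x a) D_elt = tens scale x (D a)"
proof -
  have z: "triple_scale scale 0 u = 0" and o: "triple_scale scale 1 u = u"
    and b: "S_bracket u 0 = 0" for u
    by (cases u; simp add: zero_prod_def)+
  have "triple_map D (tensor_S scale x a) = tensor_S scale x (D a)"
    by (cases x) (simp add: scale)
  moreover have "triple_map D 0 = 0"
    by (simp add: zero_prod_def zero)
  ultimately show
    "SAD_bracket scale D (tens scale x a) (tens scale y b) = tens scale (S_bracket x y) (a * b)"
    "SAD_bracket scale D (tens scale x a) D_elt = tens scale x (D a)"
    by (simp_all add: tens_def D_elt_def S_bracket_tensor z o b)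
qed

lemma (in comm_algebra) SAD_piece_iff:
  "((x, y, z), s) \<in> SAD_piece scale i \<longleftrightarrow>
     (i = -1 \<or> x = 0) \<and> (i = 0 \<or> y = 0 \<and> s = 0) \<and> (i = 1 \<or> z = 0)"
  by (auto simp: SAD_piece_def tens_def S_e_def S_h_def S_f_def D_elt_def zero_prod_def)

lemma (in derivation) SAD_bracket_piece:
  assumes "x \<in> SAD_piece scale i" "y \<in> SAD_piece scale j"
  shows "SAD_bracket scale D x y \<in> SAD_piece scale (i + j)"
  using assms by (cases x; cases y) (auto simp: SAD_piece_iff zero)

lemma (in derivation) SAD_lie_algebra:
  assumes "CHAR('k) = 2"
  shows "lie_algebra (SAD_scale scale) (SAD_bracket scale D)"
proof -
  have two: "(1::'k) + 1 = 0"
    using of_nat_CHAR[where 'a = 'k] assms by simp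
  have dbl: "a + a = 0" for a :: 'a
    using scale_left_distrib[of 1 1 a] two by simp
  have neg: "- a = a" for a :: 'a
    using dbl[of a] by (simp add: minus_unique)
  have sub: "a - b = a + b" for a b :: 'a
    using neg[of b] by (metis diff_conv_add_uminus)
  have vs: "vector_space (SAD_scale scale)"
    by unfold_locales
      (auto simp: scale_right_distrib scale_left_distrib distrib_left distrib_right)
  interpret V: vector_space "SAD_scale scale" by (rule vs)
  have mult_scale: "a * scale c b = scale c (a * b)" for a b c
    by (metis mult.commute scale_mult_left)
  have canc: "a + (a + b) = b" for a b :: 'a
    using dbl[of a] by (simp add: add.assoc[symmetric])
  note simps = add scale leibniz scale_right_distrib scale_left_distrib distrib_left distrib_right
    sub scale_mult_left[symmetric] mult_scale ac_simps
  show ?thesis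
  proof unfold_locales
    fix x y z c
    show "SAD_bracket scale D (x + z) y = SAD_bracket scale D x y + SAD_bracket scale D z y"
      "SAD_bracket scale D y (x + z) = SAD_bracket scale D y x + SAD_bracket scale D y z"
      "SAD_bracket scale D (SAD_scale scale c x) y = SAD_scale scale c (SAD_bracket scale D x y)"
      "SAD_bracket scale D y (SAD_scale scale c x) = SAD_scale scale c (SAD_bracket scale D y x)"
      by (cases x; cases y; cases z; auto simp: simps)+
    show "SAD_bracket scale D x x = 0"
      by (cases x) (auto simp: zero_prod_def mult.commute)
    show "SAD_bracket scale D (SAD_bracket scale D x y) z +
      SAD_bracket scale D (SAD_bracket scale D y z) x +
      SAD_bracket scale D (SAD_bracket scale D z x) y = 0"
      by (cases x; cases y; cases z) (auto simp: zero_prod_def simps dbl canc)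
  qed
qed

end

theory Submission
  imports Defs
begin

text \<open>
  The idea is to use a lift \<open>h0\<close> of the toral element \<open>h \<otimes> 1\<close>. On the graded algebra \<open>ad h\<close> has
  eigenvalues \<open>1\<close> in degrees \<open>\<plusminus>1\<close> and \<open>0\<close> in degree \<open>0\<close>, so \<open>T = ad h0\<close> satisfies \<open>T (T + 1)\<^sup>2 = 0\<close>.
  In characteristic two \<open>T\<^sup>2\<close> is again a derivation, and it is idempotent; hence its kernel \<open>L0\<close> and
  its image \<open>L1\<close> form a \<open>\<int>/2\<close>-grading of the deformation. The subalgebra \<open>L0\<close> maps isomorphically
  onto degree \<open>0\<close> of the graded algebra, and \<open>L1\<close> contains the top filtration step and a lift of
  \<open>e \<otimes> A\<close>. Splitting the filtration compatibly with this grading leaves only four unknown maps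
  (\<open>normal_form\<close>):

  \<open>{e a, e b} = h \<mu>(a,b) + \<xi>(a,b) D\<close>, \<open>{e a, h b} = e ab + f \<alpha>(a,b)\<close>, \<open>{e a, D} = e D(a) + f \<gamma>(a)\<close>.

  The Jacobi identity does the rest. It gives \<open>\<xi>(a,b) = \<xi>(ab,1)\<close> and, from three elements of degree
  \<open>-1\<close>, \<open>\<mu>(a,b) = b \<mu>(a,1) + a \<mu>(b,1)\<close> (\<open>\<mu>_decomp\<close>). Therefore replacing \<open>e a\<close> by
  \<open>e a + f \<mu>(a,1)\<close> removes \<open>\<mu>\<close> (\<open>shear_isomorphism\<close>). Once \<open>\<mu> = 0\<close>, the triples \<open>(e,e,h)\<close> and
  \<open>(e,e,f)\<close> force the shape of \<open>\<alpha>\<close>, the triple \<open>(e,h,D)\<close> that of \<open>\<gamma>\<close>, and the remaining conditions on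
  \<open>v\<close>, \<open>w\<close> and \<open>\<xi>\<close> are read off (\<open>structure_maps_when_\<mu>_zero\<close>).
\<close>

section \<open>Arithmetic in characteristic two\<close>

lemma char2_add_self: "CHAR('k) = 2 \<Longrightarrow> c + c = (0::'k::comm_ring_1)"
  using of_nat_CHAR[where 'a = 'k] mult_2[of c] by simp

context vector_space
begin

lemma add_self_char2:
  assumes "CHAR('a) = 2"
  shows "x + x = (0::'b)"
proof -
  have "scale (1 + 1) x = 0"
    unfolding char2_add_self[OF assms] by simp
  then show ?thesis
    unfolding scale_left_distrib by simp
qed

lemma minus_char2: "CHAR('a) = 2 \<Longrightarrow> - x = (x::'b)"
  using add_self_char2[of x] by (simp add: minus_unique)

lemma diff_char2: "CHAR('a) = 2 \<Longrightarrow> x - y = x + (y::'b)"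
  using minus_char2[of y] by (metis diff_conv_add_uminus)

lemma add_cancel_char2: "CHAR('a) = 2 \<Longrightarrow> x + (x + y) = (y::'b)"
  using add_self_char2[of x] by (simp add: add.assoc[symmetric])

lemma add_eq_0_char2: "CHAR('a) = 2 \<Longrightarrow> x + y = 0 \<longleftrightarrow> x = (y::'b)"
  by (metis diff_char2 right_minus_eq)

end

locale char2_derivation = derivation scale D
  for scale :: "'k::field \<Rightarrow> 'a::comm_ring_1 \<Rightarrow> 'a" and D :: "'a \<Rightarrow> 'a" +
  assumes char2: "CHAR('k) = 2"
begin

lemmas add_self = add_self_char2[OF char2]
  and neg_eq = minus_char2[OF char2]
  and add_cancel = add_cancel_char2[OF char2]
  and add_eq_0 = add_eq_0_char2[OF char2]

lemma scalar_add_self: "c + c = (0::'k)"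
  by (rule char2_add_self[OF char2])

lemma scalar_add_cancel: "c + (c + d) = (d::'k)"
  using scalar_add_self[of c] by (simp add: add.assoc[symmetric])

lemma scalar_add_eq_0: "c + d = (0::'k) \<longleftrightarrow> c = d"
  by (metis add.right_neutral scalar_add_cancel scalar_add_self)

lemma mult_scale_right: "a * scale c b = scale c (a * b)"
  by (metis mult.commute scale_mult_left)

lemma two_eq_0: "(2::'a) = 0"
  using add_self[of 1] by simp

lemma D_one: "D 1 = 0"
  using leibniz[of 1 1] by simp

lemma vector_space_SAD: "vector_space (SAD_scale scale)"
  using SAD_lie_algebra[OF char2] by (rule lie_algebra.axioms)

end

section \<open>Transport of structure\<close>

lemma lie_algebra_transport:
  assumes "lie_algebra s b" and iso: "lie_isomorphism s' b' s b \<psi>"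
  shows "lie_algebra s' b'"
proof -
  interpret B: lie_algebra s b by fact
  interpret \<psi>: Vector_Spaces.linear s' s \<psi>
    using iso by (simp add: lie_isomorphism_def)
  have br: "\<psi> (b' p q) = b (\<psi> p) (\<psi> q)" for p q
    using iso by (simp add: lie_isomorphism_def)
  have eqI: "p = q" if "\<psi> p = \<psi> q" for p q
    using that iso by (simp add: lie_isomorphism_def bij_def inj_eq)
  have add: "b (x + y) z = b x z + b y z" "b z (x + y) = b z x + b z y"
    and scale: "b (s c x) z = s c (b x z)" "b z (s c x) = s c (b z x)" for x y z c
    using B.linear_left[of z] B.linear_right[of z] unfolding Vector_Spaces.linear_iff by blast+
  show ?thesis
  proof
    fix p q r c
    show "b' (p + q) r = b' p r + b' q r" "b' r (p + q) = b' r p + b' r q"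
      "b' (s' c p) r = s' c (b' p r)" "b' r (s' c p) = s' c (b' r p)"
      by (rule eqI, simp add: br \<psi>.add \<psi>.scale add scale)+
    show "b' p p = 0"
      by (rule eqI) (simp add: br \<psi>.zero B.alternating)
    show "b' (b' p q) r + b' (b' q r) p + b' (b' r p) q = 0"
      by (rule eqI) (simp add: br \<psi>.add \<psi>.zero B.jacobi)
  qed
qed

lemma lie_isomorphism_compose:
  assumes "lie_isomorphism s b s' b' \<phi>" "lie_isomorphism s' b' s'' b'' \<psi>"
  shows "lie_isomorphism s b s'' b'' (\<psi> \<circ> \<phi>)"
  using assms by (auto simp: lie_isomorphism_def Vector_Spaces.linear_iff bij_comp)

lemma lie_isomorphism_inverse:
  assumes "lie_isomorphism s b s' b' \<phi>"
  shows "lie_isomorphism s' b' s b (inv \<phi>)"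
proof -
  have bij: "bij \<phi>" and lin: "Vector_Spaces.linear s s' \<phi>"
    and br: "\<And>x y. \<phi> (b x y) = b' (\<phi> x) (\<phi> y)"
    using assms by (auto simp: lie_isomorphism_def)
  note inverse = inv_f_f[OF bij_is_inj[OF bij]] surj_f_inv_f[OF bij_is_surj[OF bij]]
  have inv_eq: "inv \<phi> y = x" if "y = \<phi> x" for x y
    using that inverse by simp
  have "Vector_Spaces.linear s' s (inv \<phi>)"
    using lin unfolding Vector_Spaces.linear_iff by (auto intro!: inv_eq simp: inverse)
  then show ?thesis
    using bij by (auto simp: lie_isomorphism_def bij_imp_bij_inv br inverse intro!: inv_eq)
qed

section \<open>A normal form with four unknown maps\<close>

text \<open>
  The bracket of \<open>S \<otimes> A + K D\<close> perturbed by the maps \<open>\<mu>\<close>, \<open>\<xi>\<close>, \<open>\<alpha>\<close>, \<open>\<gamma>\<close>. The signs of \<open>S_bracket\<close> are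
  dropped, since they do not matter in characteristic two.
\<close>

fun deformed_bracket ::
  "('k::field \<Rightarrow> 'a::comm_ring_1 \<Rightarrow> 'a) \<Rightarrow> ('a \<Rightarrow> 'a) \<Rightarrow> ('a \<Rightarrow> 'a \<Rightarrow> 'a) \<Rightarrow> ('a \<Rightarrow> 'a \<Rightarrow> 'k) \<Rightarrow>
   ('a \<Rightarrow> 'a \<Rightarrow> 'a) \<Rightarrow> ('a \<Rightarrow> 'a) \<Rightarrow> ('k, 'a) SAD \<Rightarrow> ('k, 'a) SAD \<Rightarrow> ('k, 'a) SAD" where
  "deformed_bracket scale D \<mu> \<xi> \<alpha> \<gamma> ((x, y, z), s) ((x', y', z'), s') =
     ((x * y' + y * x' + (scale s' (D x) + scale s (D x')),
       \<mu> x x' + (x * z' + z * x') + (scale s' (D y) + scale s (D y')),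
       \<alpha> x y' + \<alpha> x' y + (z * y' + y * z') + (scale s' (\<gamma> x) + scale s (\<gamma> x')) +
         (scale s' (D z) + scale s (D z'))),
      \<xi> x x')"

text \<open>
  The bracket sees \<open>\<alpha>\<close> only through the sums \<open>\<alpha> x y' + \<alpha> x' y\<close>, which are unchanged when a constant
  is added to \<open>\<alpha>\<close>. The condition \<open>\<alpha> 0 0 = 0\<close> removes this ambiguity.
\<close>

locale deformed_SAD = char2_derivation scale D +
    B: lie_algebra "SAD_scale scale" "deformed_bracket scale D \<mu> \<xi> \<alpha> \<gamma>"
  for scale :: "'k::field \<Rightarrow> 'a::comm_ring_1 \<Rightarrow> 'a" and D :: "'a \<Rightarrow> 'a"
    and \<mu> :: "'a \<Rightarrow> 'a \<Rightarrow> 'a" and \<xi> :: "'a \<Rightarrow> 'a \<Rightarrow> 'k" and \<alpha> :: "'a \<Rightarrow> 'a \<Rightarrow> 'a" and \<gamma> :: "'a \<Rightarrow> 'a" +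
  assumes \<alpha>_zero_zero: "\<alpha> 0 0 = 0"
begin

abbreviation "br \<equiv> deformed_bracket scale D \<mu> \<xi> \<alpha> \<gamma>"

lemma br_add_left: "br (p + q) r = br p r + br q r"
  and br_scale_left: "br (SAD_scale scale c p) r = SAD_scale scale c (br p r)"
  using B.linear_left[of r] unfolding Vector_Spaces.linear_iff by blast+

lemma br_add_right: "br r (p + q) = br r p + br r q"
  and br_scale_right: "br r (SAD_scale scale c p) = SAD_scale scale c (br r p)"
  using B.linear_right[of r] unfolding Vector_Spaces.linear_iff by blast+

lemma \<gamma>_zero: "\<gamma> 0 = 0"
  using br_scale_left[of 0 "((0,0,0),0)" "((0,0,0),1)"] by (simp add: \<alpha>_zero_zero zero)

lemma \<alpha>_zero: "\<alpha> a 0 = 0" "\<alpha> 0 a = 0"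
  using br_scale_left[of 0 "((0,0,0),0)" "((0,a,0),0)"]
    br_scale_right[of "((a,0,0),0)" 0 "((0,0,0),0)"]
  by (simp_all add: \<alpha>_zero_zero zero)

lemmas zeros = \<gamma>_zero \<alpha>_zero

lemma \<mu>_\<xi>_add_left: "\<mu> (a + b) c = \<mu> a c + \<mu> b c" "\<xi> (a + b) c = \<xi> a c + \<xi> b c"
  and \<mu>_\<xi>_scale_left: "\<mu> (scale t a) c = scale t (\<mu> a c)" "\<xi> (scale t a) c = t * \<xi> a c"
  using br_add_left[of "((a,0,0),0)" "((b,0,0),0)" "((c,0,0),0)"]
    br_scale_left[of t "((a,0,0),0)" "((c,0,0),0)"]
  by (simp_all add: zeros)

lemma \<mu>_\<xi>_alternating: "\<mu> a a = 0" "\<xi> a a = 0"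
  using B.alternating[of "((a,0,0),0)"] by (simp_all add: zeros zero_prod_def)

lemma \<mu>_\<xi>_zero: "\<mu> 0 a = 0" "\<xi> 0 a = 0" "\<mu> a 0 = 0" "\<xi> a 0 = 0"
  using \<mu>_\<xi>_scale_left[of 0 a a] 
    br_scale_right[of "((a,0,0),0)" 0 "((0,0,0),0)"] by (simp_all add: zeros)

lemma \<mu>_\<xi>_commute: "\<mu> a b = \<mu> b a" "\<xi> a b = \<xi> b a"
proof -
  have *: "br p q + br q p = 0" for p q
    using B.alternating[of "p + q"] B.alternating[of p] B.alternating[of q]
    unfolding br_add_left br_add_right by (simp add: add.commute)
  show "\<mu> a b = \<mu> b a" "\<xi> a b = \<xi> b a"
    using *[of "((a,0,0),0)" "((b,0,0),0)"]
    by (simp_all add: zeros zero_prod_def add_eq_0 scalar_add_eq_0)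
qed

lemmas jacobi_simps = zeros \<mu>_\<xi>_zero zero_prod_def add_self scalar_add_self

text \<open>
  The Jacobi identity on triples of generators; the letters in a name list the generators. Where the
  identity has several components they are given separately.
\<close>

lemma jacobi_e_h_h: "\<alpha> (a * b) c + c * \<alpha> a b = \<alpha> (a * c) b + b * \<alpha> a c"
  using B.jacobi[of "((a,0,0),0)" "((0,b,0),0)" "((0,c,0),0)"]
  by - (rule add_eq_0[THEN iffD1], simp add: jacobi_simps ac_simps)

lemma jacobi_e_h_D: "\<gamma> (a * b) + D (\<alpha> a b) + \<alpha> a (D b) + \<alpha> (D a) b + b * \<gamma> a = 0"
  using B.jacobi[of "((a,0,0),0)" "((0,b,0),0)" "((0,0,0),1)"]
  by (simp add: jacobi_simps ac_simps)

lemma jacobi_e_e_h: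
  "\<xi> (b * c) a = \<xi> (a * c) b"
  "scale (\<xi> a b) (D c) + \<mu> (b * c) a + \<mu> (a * c) b + a * \<alpha> b c + b * \<alpha> a c = 0"
  using B.jacobi[of "((a,0,0),0)" "((b,0,0),0)" "((0,c,0),0)"]
  by (simp_all add: jacobi_simps ac_simps scalar_add_eq_0)

lemma jacobi_e_e_f:
  "c * \<mu> a b + scale (\<xi> a b) (D c) + \<alpha> a (b * c) + \<alpha> b (a * c) = 0"
  using B.jacobi[of "((a,0,0),0)" "((b,0,0),0)" "((0,0,c),0)"]
  by (simp_all add: jacobi_simps ac_simps)

lemma jacobi_e_e_D: "\<xi> (D a) b = \<xi> (D b) a"
  using B.jacobi[of "((a,0,0),0)" "((b,0,0),0)" "((0,0,0),1)"]
  by (simp add: jacobi_simps scalar_add_eq_0 ac_simps)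

lemma jacobi_e_e_e:
  "c * \<mu> a b + a * \<mu> b c + b * \<mu> c a +
     (scale (\<xi> a b) (D c) + scale (\<xi> b c) (D a) + scale (\<xi> c a) (D b)) = 0"
  "\<alpha> c (\<mu> a b) + \<alpha> a (\<mu> b c) + \<alpha> b (\<mu> c a) +
     (scale (\<xi> a b) (\<gamma> c) + scale (\<xi> b c) (\<gamma> a) + scale (\<xi> c a) (\<gamma> b)) = 0"
  using B.jacobi[of "((a,0,0),0)" "((b,0,0),0)" "((c,0,0),0)"]
  by (simp_all add: jacobi_simps ac_simps)

lemma \<xi>_mult: "\<xi> a b = \<xi> (a * b) 1"
  using jacobi_e_e_h(1)[of 1 a b] \<mu>_\<xi>_commute(2)[of a b] by (simp add: ac_simps)

text \<open>
  The triple \<open>(e a, e 1, h b)\<close> expresses \<open>\<xi>(a,1) D(b)\<close> by terms that are symmetric in \<open>a\<close> and \<open>b\<close>,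
  apart from \<open>a \<alpha>(1,b) + \<alpha>(a,b)\<close>; the triple \<open>(e 1, h a, h b)\<close> says that this is symmetric as well.
\<close>

lemma \<xi>_D_commute: "scale (\<xi> a 1) (D b) = scale (\<xi> b 1) (D a)"
proof -
  have "scale (\<xi> a 1) (D c) + (\<mu> c a + \<mu> (a * c) 1 + (a * \<alpha> 1 c + \<alpha> a c)) = 0" for a c
    using jacobi_e_e_h(2)[of a 1 c] by (simp add: ac_simps)
  then have *: "scale (\<xi> a 1) (D c) = \<mu> c a + \<mu> (a * c) 1 + (a * \<alpha> 1 c + \<alpha> a c)" for a c
    by (simp add: add_eq_0)
  have "(\<alpha> b a + a * \<alpha> 1 b) + (\<alpha> a b + b * \<alpha> 1 a) = 0"
    using jacobi_e_h_h[of 1 b a] by (simp add: add_self)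
  then have "a * \<alpha> 1 b + \<alpha> a b = b * \<alpha> 1 a + \<alpha> b a"
    by - (rule add_eq_0[THEN iffD1], simp add: ac_simps)
  then show ?thesis
    unfolding * using \<mu>_\<xi>_commute(1)[of a b] by (simp add: ac_simps)
qed

text \<open>
  With \<open>1\<close> as one of three elements of \<open>A\<close>, the \<open>e\<close>-component of the Jacobi identity on \<open>e \<otimes> A\<close> makes
  \<open>\<mu>\<close> the coboundary of \<open>\<mu>(_,1)\<close>, because the terms with \<open>\<xi>\<close> cancel by \<open>\<xi>_D_commute\<close>.
\<close>

lemma \<mu>_decomp: "\<mu> a b = b * \<mu> a 1 + a * \<mu> b 1"
proof -
  have "\<mu> a b + a * \<mu> b 1 + b * \<mu> 1 a = 0"
    using jacobi_e_e_e(1)[of 1 a b] \<xi>_D_commute[of a b] \<mu>_\<xi>_commute(2)[of 1]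
    by (simp add: D_one add_self)
  then show ?thesis
    using \<mu>_\<xi>_commute(1)[of 1 a] by - (rule add_eq_0[THEN iffD1], simp add: ac_simps)
qed

end

text \<open>
  The element \<open>1\<close> of \<open>A\<close> determines everything: the triple \<open>(e,e,h)\<close> reduces \<open>\<alpha>\<close> to \<open>\<alpha>(1,_)\<close>, the
  triple \<open>(e,e,f)\<close> makes \<open>\<alpha>(1,_)\<close> linear over \<open>A\<close>, hence multiplication by \<open>v\<close>, and the triple
  \<open>(e,h,D)\<close> makes \<open>\<gamma>\<close> multiplication by \<open>w\<close> and \<open>v\<close> a constant of \<open>D\<close>.
\<close>

lemma (in deformed_SAD) structure_maps_when_\<mu>_zero:
  assumes \<mu>0: "\<And>a b. \<mu> a b = 0"
  defines "v \<equiv> \<alpha> 1 1" and "w \<equiv> \<gamma> 1"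
  shows "\<alpha> a b = a * b * v + scale (\<xi> b 1) (D a)" and "\<gamma> a = a * w" and "D v = 0"
    and "(\<lambda>a. \<xi> a 1) \<in> Xi_D_0 scale D"
    and "(scale (\<xi> (a * b) 1) c + scale (\<xi> (c * a) 1) b + scale (\<xi> (b * c) 1) a) * w = 0"
proof -
  have \<alpha>1: "\<alpha> a c = a * \<alpha> 1 c + scale (\<xi> a 1) (D c)" for a c
    using jacobi_e_e_h(2)[of a 1 c]
    by (simp add: \<mu>0 add_eq_0 add.assoc[symmetric]) (simp add: ac_simps add_eq_0)
  \<comment> \<open>By Leibniz and \<open>\<xi>_D_commute\<close>, the first term and the sum of the other two equal
    \<open>\<xi>(c,1) D(ab)\<close>. So each of the three summands in the last condition of \<open>Xi_D_0\<close> vanishes.\<close>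
  have prod: "scale (\<xi> (a * b) 1) (D c) + scale (\<xi> a 1) (b * D c) + scale (\<xi> b 1) (a * D c) = 0"
    for a b c
  proof -
    have "scale (\<xi> a 1) (b * D c) = b * scale (\<xi> c 1) (D a)"
      and "scale (\<xi> b 1) (a * D c) = a * scale (\<xi> c 1) (D b)"
      using \<xi>_D_commute by (simp_all add: mult_scale_right[symmetric])
    moreover have "scale (\<xi> (a * b) 1) (D c) = scale (\<xi> c 1) (D (a * b))"
      by (rule \<xi>_D_commute)
    ultimately show ?thesis
      by (simp add: leibniz scale_right_distrib mult_scale_right ac_simps add_self add_cancel)
  qed
  have \<alpha>1_mult: "a * \<alpha> 1 (b * c) = b * \<alpha> 1 (a * c)" for a b c
  proof -
    have "a * \<alpha> 1 (b * c) + b * \<alpha> 1 (a * c) +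
      (scale (\<xi> (a * b) 1) (D c) + scale (\<xi> a 1) (b * D c) + scale (\<xi> b 1) (a * D c)) +
      (c * scale (\<xi> a 1) (D b) + c * scale (\<xi> b 1) (D a)) = 0"
      using jacobi_e_e_f[of c a b]
      by (simp add: \<mu>0 \<alpha>1[of a] \<alpha>1[of b] \<xi>_mult[of a b] leibniz scale_right_distrib
          mult_scale_right ac_simps)
    then show ?thesis
      unfolding prod \<xi>_D_commute[of a b] by (simp add: add_self add_eq_0)
  qed
  have \<alpha>1v: "\<alpha> 1 c = c * v" for c
    using \<alpha>1_mult[of 1 c 1] by (simp add: v_def)
  show \<alpha>: "\<alpha> a b = a * b * v + scale (\<xi> b 1) (D a)" for a b
    using \<alpha>1[of a b] \<xi>_D_commute[of a b] by (simp add: \<alpha>1v mult.assoc)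
  have *: "\<gamma> b = b * D v + b * w" for b
    using jacobi_e_h_D[of 1 b]
    by - (rule add_eq_0[THEN iffD1],
      simp add: \<alpha>1v \<alpha>_zero D_one leibniz w_def ac_simps two_eq_0)
  show Dv: "D v = 0"
    using *[of 1] by (simp add: w_def)
  show \<gamma>: "\<gamma> a = a * w" for a
    using *[of a] Dv by simp
  show "(scale (\<xi> (a * b) 1) c + scale (\<xi> (c * a) 1) b + scale (\<xi> (b * c) 1) a) * w = 0"
    using jacobi_e_e_e(2)[of c a b]
    by (simp add: \<mu>0 \<alpha>_zero \<gamma> \<xi>_mult[of a b] \<xi>_mult[of b c] \<xi>_mult[of c a] distrib_left
        mult_scale_right ac_simps)
  have lin: "Vector_Spaces.linear scale (*) (\<lambda>a. \<xi> a 1)"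
    using vector_space_axioms
    by (auto simp: Vector_Spaces.linear_iff \<mu>_\<xi>_add_left \<mu>_\<xi>_scale_left algebra_simps
        intro!: vector_space.intro)
  interpret \<xi>: Vector_Spaces.linear scale "(*)" "\<lambda>a. \<xi> a 1" by (rule lin)
  have "\<xi> a 1 = 0" if "a \<in> square_span scale" for a
    using that unfolding square_span_def
  proof (induction rule: span_induct_alt)
    case base
    show ?case by (simp add: \<mu>_\<xi>_zero)
  next
    case (step c x y)
    have "\<xi> x 1 = 0"
    proof -
      obtain y where "x = y * y"
        using step(1) by (auto simp: power2_eq_square)
      then show ?thesis
        using \<mu>_\<xi>_alternating(2)[of y] \<xi>_mult[of y y] by simp
    qed
    then show ?case
      using step by (simp add: \<mu>_\<xi>_add_left \<mu>_\<xi>_scale_left)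
  qed
  moreover have "\<xi> (D a) 1 = 0" for a
    using jacobi_e_e_D[of a 1] by (simp add: D_one \<mu>_\<xi>_zero)
  moreover have "(scale (\<xi> a 1) b + scale (\<xi> b 1) a + scale (\<xi> (a * b) 1) 1) * D c = 0" for a b c
    using prod[of a b c] by (simp add: distrib_left mult_scale_right ac_simps)
  ultimately show "(\<lambda>a. \<xi> a 1) \<in> Xi_D_0 scale D"
    using lin \<xi>_D_commute by (auto simp: Xi_D_0_def add_eq_0)
qed

context deformed_SAD
begin

text \<open>
  The change of basis \<open>e a \<mapsto> e a + f \<mu>(a,1)\<close>. By \<open>\<mu>_decomp\<close> it moves the bracket with \<open>\<mu> = 0\<close> and
  the correspondingly adjusted \<open>\<alpha>\<close> and \<open>\<gamma>\<close> to the given one.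
\<close>

fun shear :: "('k, 'a) SAD \<Rightarrow> ('k, 'a) SAD" where
  "shear ((x, y, z), s) = ((x, y, z + \<mu> x 1), s)"

lemma shear_isomorphism:
  "lie_isomorphism (SAD_scale scale)
     (deformed_bracket scale D (\<lambda>a b. 0) \<xi> (\<lambda>a b. \<alpha> a b + b * \<mu> a 1 + \<mu> (a * b) 1)
        (\<lambda>a. \<gamma> a + D (\<mu> a 1) + \<mu> (D a) 1))
     (SAD_scale scale) br shear"
proof -
  note simps = \<mu>_\<xi>_add_left \<mu>_\<xi>_scale_left
  have "shear (shear p) = p" for p
    by (cases p rule: shear.cases) (simp add: add.assoc add_self)
  then have "bij shear"
    by (intro o_bij[of shear]) (auto simp: fun_eq_iff)
  moreover have "Vector_Spaces.linear (SAD_scale scale) (SAD_scale scale) shear"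
    using vector_space_SAD
    by (auto simp: Vector_Spaces.linear_iff simps scale_right_distrib ac_simps)
  moreover have "shear (deformed_bracket scale D (\<lambda>a b. 0) \<xi>
       (\<lambda>a b. \<alpha> a b + b * \<mu> a 1 + \<mu> (a * b) 1) (\<lambda>a. \<gamma> a + D (\<mu> a 1) + \<mu> (D a) 1) p q) =
     br (shear p) (shear q)" for p q
  proof -
    obtain x y z s x' y' z' s' where "p = ((x, y, z), s)" "q = ((x', y', z'), s')"
      by (metis prod.exhaust)
    then show ?thesis
      using \<mu>_decomp[of x x']
      by (simp add: simps add scale scale_right_distrib distrib_left distrib_right ac_simps
          add_self add_cancel)
  qed
  ultimately show ?thesis
    by (simp add: lie_isomorphism_def)
qed

end

section \<open>Splitting the filtration\<close>

text \<open>
  The map \<open>symbol i\<close> sends an element of \<open>F i\<close> to its class in \<open>F i / F (i + 1)\<close>, read in degree \<open>i\<close> of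
  \<open>S \<otimes> A + K D\<close>. It takes the place of the cosets of the associated graded algebra; its values
  outside \<open>F i\<close> carry no meaning.
\<close>

locale SAD_deformation = char2_derivation scale D + L: filtered_lie_algebra scaleL brL F
  for scale :: "'k::field \<Rightarrow> 'a::comm_ring_1 \<Rightarrow> 'a" and D :: "'a \<Rightarrow> 'a"
    and scaleL :: "'k \<Rightarrow> 'l::ab_group_add \<Rightarrow> 'l" and brL :: "'l \<Rightarrow> 'l \<Rightarrow> 'l"
    and F :: "int \<Rightarrow> 'l set" +
  fixes symbol :: "int \<Rightarrow> 'l \<Rightarrow> ('k, 'a) SAD"
  assumes symbol_piece: "x \<in> F i \<Longrightarrow> symbol i x \<in> SAD_piece scale i"
    and symbol_surj: "p \<in> SAD_piece scale i \<Longrightarrow> \<exists>x\<in>F i. symbol i x = p"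
    and symbol_eq_iff: "x \<in> F i \<Longrightarrow> y \<in> F i \<Longrightarrow> symbol i x = symbol i y \<longleftrightarrow> x - y \<in> F (i + 1)"
    and symbol_add: "x \<in> F i \<Longrightarrow> y \<in> F i \<Longrightarrow> symbol i (x + y) = symbol i x + symbol i y"
    and symbol_scale: "x \<in> F i \<Longrightarrow> symbol i (scaleL c x) = SAD_scale scale c (symbol i x)"
    and symbol_bracket: "x \<in> F i \<Longrightarrow> y \<in> F j \<Longrightarrow>
      symbol (i + j) (brL x y) = SAD_bracket scale D (symbol i x) (symbol j y)"

lemma symbol_map_exists:
  fixes scale :: "'k::field \<Rightarrow> 'a::comm_ring_1 \<Rightarrow> 'a"
    and scaleL :: "'k \<Rightarrow> 'l::ab_group_add \<Rightarrow> 'l"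
  assumes "CHAR('k) = 2" "derivation scale D"
    and "filtered_deformation scaleL brL F (SAD_graded scale D)"
  shows "\<exists>symbol. SAD_deformation scale D scaleL brL F symbol"
proof -
  interpret derivation scale D by fact
  obtain \<phi> where "filtered_lie_algebra scaleL brL F"
    and \<phi>: "graded_lie_isomorphism (assoc_graded scaleL brL F) (SAD_graded scale D) \<phi>"
    using assms(3) by (auto simp: filtered_deformation_def)
  interpret L: filtered_lie_algebra scaleL brL F by fact
  let ?G = "assoc_graded scaleL brL F"
  define symbol where "symbol i x = \<phi> i (x +o F (i + 1))" for i x
  have coset: "x +o F (i + 1) \<in> piece ?G i" if "x \<in> F i" for x i
    using that by (auto simp: assoc_graded_def)
  have bij: "bij_betw (\<phi> i) (piece ?G i) (SAD_piece scale i)"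
    and add: "X \<in> piece ?G i \<Longrightarrow> Y \<in> piece ?G i \<Longrightarrow> \<phi> i (gadd ?G i X Y) = \<phi> i X + \<phi> i Y"
    and scale: "X \<in> piece ?G i \<Longrightarrow> \<phi> i (gscale ?G i c X) = SAD_scale scale c (\<phi> i X)"
    and br: "X \<in> piece ?G i \<Longrightarrow> Y \<in> piece ?G j \<Longrightarrow>
      \<phi> (i + j) (gbracket ?G i j X Y) = SAD_bracket scale D (\<phi> i X) (\<phi> j Y)" for i j X Y c
    using \<phi> by (auto simp: graded_lie_isomorphism_def SAD_graded_def)
  have "SAD_deformation scale D scaleL brL F symbol"
  proof unfold_locales
    fix i j x y c p
    show "CHAR('k) = 2" by fact
    show "\<exists>x\<in>F i. symbol i x = p" if "p \<in> SAD_piece scale i"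
    proof -
      have "p \<in> \<phi> i ` {x +o F (i + 1) | x. x \<in> F i}"
        using that bij_betw_imp_surj_on[OF bij[of i]] by (simp add: assoc_graded_def)
      then show ?thesis
        by (auto simp: symbol_def)
    qed
    assume x: "x \<in> F i"
    show "symbol i x \<in> SAD_piece scale i"
      using bij_betwE[OF bij] coset[OF x] by (simp add: symbol_def)
    show "symbol i (scaleL c x) = SAD_scale scale c (symbol i x)"
      using scale[OF coset[OF x]] by (simp add: symbol_def L.assoc_graded_ops)
    show "symbol (i + j) (brL x y) = SAD_bracket scale D (symbol i x) (symbol j y)" if y: "y \<in> F j"
      using br[OF coset[OF x] coset[OF y]] by (simp add: symbol_def L.assoc_graded_ops x y)
    assume y: "y \<in> F i"
    show "symbol i (x + y) = symbol i x + symbol i y"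
      using add[OF coset[OF x] coset[OF y]] by (simp add: symbol_def L.assoc_graded_ops)
    show "symbol i x = symbol i y \<longleftrightarrow> x - y \<in> F (i + 1)"
      using inj_on_eq_iff[OF bij_betw_imp_inj_on[OF bij[of i]] coset[OF x] coset[OF y]]
      by (simp add: symbol_def L.coset_eq_iff)
  qed
  then show ?thesis
    by blast
qed

context SAD_deformation
begin

lemmas L_add_self = L.add_self_char2[OF char2]
  and L_diff_eq = L.diff_char2[OF char2]
  and L_add_cancel = L.add_cancel_char2[OF char2]
  and L_add_eq_0 = L.add_eq_0_char2[OF char2]

lemmas F_add = L.subspace_add[OF L.subspace_filtration]
  and F_scale = L.subspace_scale[OF L.subspace_filtration]
  and F_zero = L.subspace_0[OF L.subspace_filtration]

lemma F_mono: "i \<le> j \<Longrightarrow> x \<in> F j \<Longrightarrow> x \<in> F i"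
  using L.descending antimonoD by blast

lemma symbol_zero: "symbol i 0 = 0"
  using symbol_add[of 0 i 0] F_zero by simp

lemma symbol_eq_0_iff: "x \<in> F i \<Longrightarrow> symbol i x = 0 \<longleftrightarrow> x \<in> F (i + 1)"
  using symbol_eq_iff[of x i 0] F_zero by (simp add: symbol_zero)

lemma symbol_eqD: "x \<in> F i \<Longrightarrow> y \<in> F i \<Longrightarrow> symbol i x = symbol i y \<Longrightarrow> x + y \<in> F (i + 1)"
  using symbol_eq_iff[of x i y] by (simp add: L_diff_eq)

lemma F_succ: "x \<in> F i \<Longrightarrow> i \<notin> {-1, 0, 1} \<Longrightarrow> x \<in> F (i + 1)"
  using symbol_piece[of x i] symbol_eq_0_iff[of x i] by (auto simp: SAD_piece_def)

text \<open>
  The graded algebra lives in degrees \<open>-1\<close>, \<open>0\<close> and \<open>1\<close>, so the filtration is constant below \<open>-1\<close> and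
  above \<open>1\<close>; being exhaustive and separated, it runs from the whole space to zero.
\<close>

lemma F_top: "x \<in> F (-1)"
proof -
  have "x \<in> F (- 1 - int n) \<Longrightarrow> x \<in> F (-1)" for n
  proof (induction n)
    case (Suc n)
    then show ?case using F_succ[of x "- 1 - int (Suc n)"] by (simp add: algebra_simps)
  qed simp
  moreover obtain i where "x \<in> F i"
    using L.exhaustive by blast
  then have "x \<in> F (- 1 - int (nat \<bar>i\<bar>))"
    by (rule F_mono[rotated]) simp
  ultimately show ?thesis by blast
qed

lemma F_bot: "x \<in> F 2 \<Longrightarrow> x = 0"
proof -
  assume x: "x \<in> F 2"
  have n: "x \<in> F (2 + int n)" for n
  proof (induction n)
    case (Suc n)
    then show ?case using F_succ[of x "2 + int n"] by (simp add: algebra_simps)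
  qed (simp add: x)
  have "x \<in> F i" for i
    by (rule F_mono[OF _ n[of "nat \<bar>i\<bar>"]]) simp
  then show "x = 0"
    using L.separated by blast
qed

lemma br_linear:
  "brL (x + y) z = brL x z + brL y z" "brL z (x + y) = brL z x + brL z y"
  "brL (scaleL c x) z = scaleL c (brL x z)" "brL z (scaleL c x) = scaleL c (brL z x)"
  using L.linear_left[of z] L.linear_right[of z] unfolding Vector_Spaces.linear_iff by blast+

lemma br_zero: "brL x 0 = 0" "brL 0 x = 0"
  using br_linear(2)[of x 0 0] br_linear(1)[of 0 0 x] by simp_all

lemma br_commute: "brL x y = brL y x"
proof -
  have "brL x y + brL y x = 0"
    using L.alternating[of "x + y"] L.alternating[of x] L.alternating[of y]
    unfolding br_linear by (simp add: add.commute)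
  then show ?thesis by (simp add: L_add_eq_0)
qed

lemma br_derivation: "brL u (brL x y) = brL (brL u x) y + brL x (brL u y)"
proof -
  have "brL u (brL x y) + (brL (brL u x) y + brL x (brL u y)) = 0"
    using L.jacobi[of u x y] br_commute[of "brL x y" u] br_commute[of y u]
      br_commute[of "brL u y" x] by (simp add: ac_simps)
  then show ?thesis by (simp add: L_add_eq_0)
qed

lemma symbol_F1:
  assumes "x \<in> F 1"
  obtains c where "symbol 1 x = ((0, 0, c), 0)"
  using symbol_piece[OF assms] by (cases "symbol 1 x") (auto simp: SAD_piece_iff)

lemma symbol_F0:
  assumes "x \<in> F 0"
  obtains b s where "symbol 0 x = ((0, b, 0), s)"
  using symbol_piece[OF assms] by (cases "symbol 0 x") (auto simp: SAD_piece_iff)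

lemma symbol_top: obtains a where "symbol (-1) x = ((a, 0, 0), 0)"
  using symbol_piece[OF F_top[of x]] by (cases "symbol (-1) x") (auto simp: SAD_piece_iff)

end

locale SAD_deformation_torus = SAD_deformation scale D scaleL brL F symbol
  for scale :: "'k::field \<Rightarrow> 'a::comm_ring_1 \<Rightarrow> 'a" and D :: "'a \<Rightarrow> 'a"
    and scaleL :: "'k \<Rightarrow> 'l::ab_group_add \<Rightarrow> 'l" and brL :: "'l \<Rightarrow> 'l \<Rightarrow> 'l"
    and F :: "int \<Rightarrow> 'l set" and symbol :: "int \<Rightarrow> 'l \<Rightarrow> ('k, 'a) SAD" +
  fixes h0 :: 'l
  assumes h0: "h0 \<in> F 0" "symbol 0 h0 = ((0, 1, 0), 0)"
begin

abbreviation T where "T x \<equiv> brL h0 x"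

lemma symbol_T: "x \<in> F i \<Longrightarrow> symbol i (T x) = SAD_bracket scale D ((0, 1, 0), 0) (symbol i x)"
  using symbol_bracket[OF h0(1)] h0(2) by fastforce

lemma T_F: "x \<in> F i \<Longrightarrow> T x \<in> F i"
  using L.bracket_filtration[OF h0(1)] by fastforce

text \<open>
  The next three lemmas say that \<open>T\<close> acts on the three filtration quotients as \<open>1\<close>, \<open>0\<close> and \<open>1\<close>.
\<close>

lemma T_F1: assumes "x \<in> F 1" shows "T x = x"
proof -
  obtain c where "symbol 1 x = ((0, 0, c), 0)"
    using assms by (rule symbol_F1)
  then have "symbol 1 (T x) = symbol 1 x"
    using assms by (simp add: symbol_T zero neg_eq zero_prod_def)
  then have "T x + x \<in> F (1 + 1)"
    using assms T_F symbol_eqD by blast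
  then show ?thesis
    using F_bot[of "T x + x"] by (simp add: L_add_eq_0)
qed

lemma T_F0: assumes "x \<in> F 0" shows "T x \<in> F 1"
proof -
  obtain b s where "symbol 0 x = ((0, b, 0), s)"
    using assms by (rule symbol_F0)
  then have "symbol 0 (T x) = 0"
    using assms by (simp add: symbol_T zero D_one zero_prod_def)
  then show ?thesis
    using symbol_eq_0_iff[OF T_F[OF assms]] by simp
qed

lemma T_top: "symbol (-1) (T x) = symbol (-1) x"
proof -
  obtain a where "symbol (-1) x = ((a, 0, 0), 0)"
    by (rule symbol_top)
  then show ?thesis
    by (simp add: symbol_T[OF F_top] zero neg_eq zero_prod_def)
qed

lemma T_add_top: "T x + x \<in> F 0"
  using symbol_eqD[OF F_top F_top T_top, of x] by simp

text \<open>
  The two parts of the \<open>\<int>/2\<close>-grading, the eigenspaces of \<open>T\<^sup>2\<close>. On \<open>L1\<close> the square is essential: \<open>T\<close>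
  itself is only known to be unipotent there, since \<open>(T + 1) x\<close> may be a nonzero element of \<open>F 1\<close>.
\<close>

definition "L0 = {x. T x = 0}"
definition "L1 = {x. T (T x) = x}"

lemma L0_F0: assumes "x \<in> L0" shows "x \<in> F 0"
  using T_add_top[of x] assms by (simp add: L0_def)

lemma L0_F1: "x \<in> L0 \<Longrightarrow> x \<in> F 1 \<Longrightarrow> x = 0"
  using T_F1[of x] by (simp add: L0_def)

lemma L1_F0: assumes "x \<in> L1" "x \<in> F 0" shows "x \<in> F 1"
  using T_F[OF T_F0[OF assms(2)]] assms(1) by (simp add: L1_def)

lemma F1_L1: "x \<in> F 1 \<Longrightarrow> x \<in> L1"
  by (simp add: L1_def T_F1)

text \<open>
  This is \<open>T\<^sup>4 = T\<^sup>2\<close>, a consequence of \<open>T (T + 1)\<^sup>2 = 0\<close>: the map \<open>T + 1\<close> sends everything into \<open>F 0\<close>,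
  then \<open>T\<close> sends \<open>F 0\<close> into \<open>F 1\<close>, where \<open>T\<close> is the identity.
\<close>

lemma TT_in_L1: "T (T x) \<in> L1"
proof -
  have TTT: "T (T (T u)) = T u" if "u \<in> F 0" for u
    using T_F1[OF T_F0[OF that]] by simp
  have "T (T (T (T x + x))) = T (T x + x)"
    using T_add_top by (rule TTT)
  moreover have "T (T (T (T (T x + x)))) = T (T (T x + x))"
    using arg_cong[OF calculation, of T] .
  moreover have "T (T (T x + x)) = T (T x + x)"
    using T_F1[OF T_F0[OF T_add_top]] .
  ultimately have "T (T (T (T x))) + T (T x) = 0"
    by (simp add: br_linear L_add_self L_add_eq_0)
  then show ?thesis by (simp add: L1_def L_add_eq_0)
qed

text \<open>
  The cross term \<open>2 {T x, T y}\<close> of the second power of a derivation vanishes in characteristic two.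
\<close>

lemma TT_derivation: "T (T (brL x y)) = brL (T (T x)) y + brL x (T (T y))"
  by (simp add: br_derivation[of h0 x y] br_linear br_derivation[of h0 "T x" y]
      br_derivation[of h0 x "T y"] add.assoc L_add_cancel)

lemma L0_L0: "x \<in> L0 \<Longrightarrow> y \<in> L0 \<Longrightarrow> brL x y \<in> L0"
  by (simp add: L0_def br_derivation[of h0 x y] br_zero)

lemma L1_L0: "x \<in> L1 \<Longrightarrow> y \<in> L0 \<Longrightarrow> brL x y \<in> L1"
  by (simp add: L0_def L1_def TT_derivation br_zero)

text \<open>
  The derivation \<open>T\<^sup>2\<close> multiplies \<open>{x, y}\<close> by \<open>1 + 1 = 0\<close>. Since \<open>T\<close> preserves symbols of degree \<open>-1\<close>, such a
  bracket lies in \<open>F 0\<close>, where \<open>T\<^sup>2 = T\<close>.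
\<close>

lemma L1_L1: assumes "x \<in> L1" "y \<in> L1" shows "brL x y \<in> L0"
proof -
  have TT: "T (T (brL x y)) = 0"
    using assms by (simp add: L1_def TT_derivation L_add_self)
  have "symbol (-1) (brL x y) = 0"
    using T_top[of "brL x y"] T_top[of "T (brL x y)"] TT by (simp add: symbol_zero)
  then have "brL x y \<in> F 0"
    using symbol_eq_0_iff[OF F_top] by simp
  then have "T (T (brL x y)) = T (brL x y)"
    by (intro T_F1 T_F0)
  then show ?thesis using TT by (simp add: L0_def)
qed

lemma L0_add: "x \<in> L0 \<Longrightarrow> y \<in> L0 \<Longrightarrow> x + y \<in> L0" and L0_scale: "x \<in> L0 \<Longrightarrow> scaleL c x \<in> L0"
  and L1_add: "x \<in> L1 \<Longrightarrow> y \<in> L1 \<Longrightarrow> x + y \<in> L1"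
  by (simp_all add: L0_def L1_def br_linear)

lemma L0_unique: "x \<in> L0 \<Longrightarrow> y \<in> L0 \<Longrightarrow> symbol 0 x = symbol 0 y \<Longrightarrow> x = y"
  using L0_F1[OF L0_add[of x y]] symbol_eqD[OF L0_F0 L0_F0, of x y] by (simp add: L_add_eq_0)

lemma F1_unique: "x \<in> F 1 \<Longrightarrow> y \<in> F 1 \<Longrightarrow> symbol 1 x = symbol 1 y \<Longrightarrow> x = y"
  using F_bot[of "x + y"] symbol_eqD[of x 1 y] by (simp add: L_add_eq_0)

text \<open>
  For any lift \<open>y\<close> in \<open>F 0\<close> the correction \<open>T y\<close> lies in \<open>F 1\<close> and \<open>T (y + T y) = 2 T y = 0\<close>.
\<close>

lemma lift_L0: "\<exists>x\<in>L0. symbol 0 x = ((0, b, 0), s)"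
proof -
  obtain y where y: "y \<in> F 0" "symbol 0 y = ((0, b, 0), s)"
    using symbol_surj[of "((0, b, 0), s)" 0] by (auto simp: SAD_piece_iff)
  have "T (y + T y) = 0"
    using T_F1[OF T_F0[OF y(1)]] by (simp add: br_linear L_add_self)
  moreover have "symbol 0 (y + T y) = ((0, b, 0), s)"
    using symbol_add[OF y(1) T_F[OF y(1)]] symbol_eq_0_iff[OF T_F[OF y(1)]] T_F0[OF y(1)] y(2) by simp
  ultimately show ?thesis
    by (auto simp: L0_def)
qed

definition lift_h :: "'a \<Rightarrow> 'k \<Rightarrow> 'l"
  where "lift_h b s = (SOME x. x \<in> L0 \<and> symbol 0 x = ((0, b, 0), s))"

definition lift_f :: "'a \<Rightarrow> 'l"
  where "lift_f c = (SOME x. x \<in> F 1 \<and> symbol 1 x = ((0, 0, c), 0))"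

lemma lift_h: "lift_h b s \<in> L0" "symbol 0 (lift_h b s) = ((0, b, 0), s)"
proof -
  have "\<exists>x. x \<in> L0 \<and> symbol 0 x = ((0, b, 0), s)"
    using lift_L0 by blast
  then show "lift_h b s \<in> L0" "symbol 0 (lift_h b s) = ((0, b, 0), s)"
    unfolding lift_h_def by (rule someI2_ex, blast)+
qed

lemma lift_f: "lift_f c \<in> F 1" "symbol 1 (lift_f c) = ((0, 0, c), 0)"
proof -
  have "\<exists>x. x \<in> F 1 \<and> symbol 1 x = ((0, 0, c), 0)"
    using symbol_surj[of "((0, 0, c), 0)" 1] by (auto simp: SAD_piece_iff)
  then show "lift_f c \<in> F 1" "symbol 1 (lift_f c) = ((0, 0, c), 0)"
    unfolding lift_f_def by (rule someI2_ex, blast)+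
qed

lemma eq_lift_h: "x \<in> L0 \<Longrightarrow> symbol 0 x = ((0, b, 0), s) \<Longrightarrow> x = lift_h b s"
  by (rule L0_unique) (simp_all add: lift_h)

lemma eq_lift_f: "x \<in> F 1 \<Longrightarrow> symbol 1 x = ((0, 0, c), 0) \<Longrightarrow> x = lift_f c"
  by (rule F1_unique) (simp_all add: lift_f)

lemma lift_h_F0: "lift_h b s \<in> F 0"
  by (rule L0_F0[OF lift_h(1)])

lemma lift_f_L1: "lift_f c \<in> L1"
  by (rule F1_L1[OF lift_f(1)])

lemma lift_h_linear:
  "lift_h (b + b') (s + s') = lift_h b s + lift_h b' s'"
  "lift_h (scale c b) (c * s) = scaleL c (lift_h b s)"
  by (rule eq_lift_h[symmetric],
      simp_all add: L0_add L0_scale symbol_add symbol_scale lift_h lift_h_F0)+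

lemma lift_f_linear:
  "lift_f (c + c') = lift_f c + lift_f c'" "lift_f (scale s c) = scaleL s (lift_f c)"
  by (rule eq_lift_f[symmetric], simp_all add: F_add F_scale symbol_add symbol_scale lift_f)+

lemma lift_f_eq_0: "lift_f c = 0 \<longleftrightarrow> c = 0"
  using lift_f(2)[of c] lift_f_linear(2)[of 0 0] by (auto simp: symbol_zero zero_prod_def)

lemma lift_h_split: "lift_h b s = lift_h b 0 + scaleL s (lift_h 0 1)"
  using lift_h_linear(1)[of b 0 0 s] lift_h_linear(2)[of s 0 1] by simp

text \<open>
  Lifts of \<open>e \<otimes> A\<close> to \<open>L1\<close> are not unique, so linearity has to be arranged by a linear section of the
  symbol map; applying \<open>T\<^sup>2\<close> moves the section into \<open>L1\<close> without changing symbols.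
\<close>

lemma lift_e_exists:
  "\<exists>E. Vector_Spaces.linear scale scaleL E \<and> (\<forall>a. E a \<in> L1 \<and> symbol (-1) (E a) = ((a, 0, 0), 0))"
proof -
  define p where "p x = fst (fst (symbol (-1) x))" for x
  have symbol_p: "symbol (-1) x = ((p x, 0, 0), 0)" for x
    by (rule symbol_top[of x]) (simp add: p_def)
  have p_linear: "Vector_Spaces.linear scaleL scale p"
    using L.vector_space_axioms vector_space_axioms symbol_add[OF F_top F_top] symbol_scale[OF F_top]
    by (auto simp: Vector_Spaces.linear_iff symbol_p)
  have "surj p"
    unfolding surj_def
  proof
    fix a
    obtain x where "symbol (-1) x = ((a, 0, 0), 0)"
      using symbol_surj[of "((a, 0, 0), 0)" "-1"] by (auto simp: SAD_piece_iff)
    then have "a = p x"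
      by (simp add: p_def)
    then show "\<exists>x. a = p x" ..
  qed
  interpret pair: vector_space_pair scaleL scale ..
  obtain g where g: "Vector_Spaces.linear scale scaleL g" "p \<circ> g = id"
    using pair.linear_surjective_right_inverse[OF p_linear \<open>surj p\<close>] by blast
  have "Vector_Spaces.linear scale scaleL (\<lambda>a. T (T (g a)))"
    using g(1) by (auto simp: Vector_Spaces.linear_iff br_linear)
  moreover have "symbol (-1) (g a) = ((a, 0, 0), 0)" for a
    using g(2) by (simp add: symbol_p fun_eq_iff)
  then have "symbol (-1) (T (T (g a))) = ((a, 0, 0), 0)" for a
    by (simp add: T_top)
  ultimately show ?thesis
    using TT_in_L1 by blast
qed

text \<open>
  Elements of \<open>L0\<close>, and of \<open>F 1\<close>, are determined by their symbols, so brackets with values there agree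
  with those of the graded algebra. Only brackets of two lifts of \<open>e \<otimes> A\<close>, whose symbol of degree \<open>-2\<close>
  carries no information, and brackets of such a lift with \<open>L0\<close>, which are known up to \<open>F 1\<close>, are free.
\<close>

lemma normal_form:
  "\<exists>\<mu> \<xi> \<alpha> \<gamma> \<psi>. deformed_SAD scale D \<mu> \<xi> \<alpha> \<gamma> \<and>
     lie_isomorphism (SAD_scale scale) (deformed_bracket scale D \<mu> \<xi> \<alpha> \<gamma>) scaleL brL \<psi>"
proof -
  obtain E where E_linear: "Vector_Spaces.linear scale scaleL E"
    and E_L1: "\<And>a. E a \<in> L1" and symbol_E: "\<And>a. symbol (-1) (E a) = ((a, 0, 0), 0)"
    using lift_e_exists by blast
  interpret E: Vector_Spaces.linear scale scaleL E by (rule E_linear)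
  define d where "d = lift_h 0 1"
  define H where "H b = lift_h b 0" for b
  have lift_h_eq: "lift_h b s = H b + scaleL s d" for b s
    unfolding H_def d_def by (rule lift_h_split)
  have H_linear: "H (b + b') = H b + H b'" "H (scale c b) = scaleL c (H b)" for b b' c
    using lift_h_linear(1)[of b b' 0 0] lift_h_linear(2)[of c b 0] by (simp_all add: H_def)
  have H0: "H 0 = 0"
    using H_linear(2)[of 0 0] by simp
  have L0_eq: "\<exists>b s. x = H b + scaleL s d" if "x \<in> L0" for x
    using symbol_F0[OF L0_F0[OF that]] eq_lift_h[OF that] by (metis lift_h_eq)
  have L1_eq: "\<exists>c. x = E a + lift_f c" if x: "x \<in> L1" and "symbol (-1) x = ((a, 0, 0), 0)" for x a
  proof -
    have "x + E a \<in> F 0"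
      using symbol_eqD[OF F_top F_top, of x "E a"] that symbol_E by simp
    then have F1: "x + E a \<in> F 1"
      using x E_L1 L1_F0 L1_add by blast
    obtain c where "symbol 1 (x + E a) = ((0, 0, c), 0)"
      using symbol_F1[OF F1] .
    then have "E a + lift_f c = E a + (E a + x)"
      using eq_lift_f[OF F1] by (simp add: add.commute)
    then show ?thesis
      unfolding L_add_cancel by metis
  qed
  have HL0: "H b \<in> L0" and dL0: "d \<in> L0"
    and symH: "symbol 0 (H b) = ((0, b, 0), 0)" and symd: "symbol 0 d = ((0, 0, 0), 1)" for b
    by (simp_all add: H_def d_def lift_h)
  note F0 = L0_F0[OF HL0] L0_F0[OF dL0]

  have "\<exists>b s. brL (E x) (E y) = H b + scaleL s d" for x y
    using L0_eq[OF L1_L1[OF E_L1 E_L1]] .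
  then obtain \<mu> \<xi> where EE: "\<And>x y. brL (E x) (E y) = H (\<mu> x y) + scaleL (\<xi> x y) d"
    by metis
  have "symbol (-1) (brL (E x) (H y)) = ((x * y, 0, 0), 0)" for x y
    using symbol_bracket[OF F_top F0(1), of "E x" y] by (simp add: symbol_E symH zero zero_prod_def)
  then have "\<exists>c. brL (E x) (H y) = E (x * y) + lift_f c" for x y
    by (rule L1_eq[OF L1_L0[OF E_L1 HL0]])
  then obtain \<alpha> where EH: "\<And>x y. brL (E x) (H y) = E (x * y) + lift_f (\<alpha> x y)"
    by metis
  have "symbol (-1) (brL (E x) d) = ((D x, 0, 0), 0)" for x
    using symbol_bracket[OF F_top F0(2), of "E x"] by (simp add: symbol_E symd zero zero_prod_def)
  then have "\<exists>c. brL (E x) d = E (D x) + lift_f c" for x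
    by (rule L1_eq[OF L1_L0[OF E_L1 dL0]])
  then obtain \<gamma> where Ed: "\<And>x. brL (E x) d = E (D x) + lift_f (\<gamma> x)"
    by metis
  have EF: "brL (E x) (lift_f z) = H (x * z)" for x z
    using eq_lift_h[OF L1_L1[OF E_L1 lift_f_L1], of x z "x * z" 0]
      symbol_bracket[OF F_top lift_f(1), of "E x" z]
    by (simp add: symbol_E lift_f H_def zero zero_prod_def)
  have HH: "brL (H b) (H b') = 0" for b b'
    using eq_lift_h[OF L0_L0[OF HL0 HL0], of b b' 0 0] symbol_bracket[OF F0(1) F0(1), of b b'] H0
    by (simp add: lift_h H_def zero zero_prod_def)
  have Hd: "brL (H b) d = H (D b)" for b
    using eq_lift_h[OF L0_L0[OF HL0 dL0], of b "D b" 0] symbol_bracket[OF F0(1) F0(2), of b]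
    by (simp add: lift_h symd H_def zero zero_prod_def)
  have HF: "brL (H b) (lift_f c) = lift_f (b * c)" for b c
    using eq_lift_f[of "brL (H b) (lift_f c)" "b * c"] symbol_bracket[OF F0(1) lift_f(1), of b c]
      L.bracket_filtration[OF F0(1) lift_f(1), of b c]
    by (simp add: symH lift_f zero neg_eq zero_prod_def)
  have Fd: "brL (lift_f c) d = lift_f (D c)" for c
    using eq_lift_f[of "brL (lift_f c) d" "D c"] symbol_bracket[OF lift_f(1) F0(2), of c]
      L.bracket_filtration[OF lift_f(1) F0(2), of c]
    by (simp add: symd lift_f zero zero_prod_def)
  have FF: "brL (lift_f c) (lift_f c') = 0" for c c'
    using L.bracket_filtration[OF lift_f(1) lift_f(1), of c c'] F_bot by simp
  note brackets = EE EH Ed EF HH Hd HF Fd FF L.alternating[of d]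
    EH[unfolded br_commute[of "E _"]] Ed[unfolded br_commute[of "E _"]]
    EF[unfolded br_commute[of "E _"]] Hd[unfolded br_commute[of _ d]]
    HF[unfolded br_commute[of "H _"]] Fd[unfolded br_commute[of _ d]]

  define \<psi> :: "('k, 'a) SAD \<Rightarrow> 'l"
    where "\<psi> = (\<lambda>((x, y, z), s). E x + H y + lift_f z + scaleL s d)"
  have \<psi>: "\<psi> ((x, y, z), s) = E x + (lift_h y s + lift_f z)" for x y z s
    by (simp add: \<psi>_def lift_h_eq ac_simps)
  have \<psi>_linear: "Vector_Spaces.linear (SAD_scale scale) scaleL \<psi>"
    using vector_space_SAD L.vector_space_axioms
    by (auto simp: Vector_Spaces.linear_iff \<psi>_def E.add E.scale H_linear lift_f_linear
        L.scale_left_distrib L.scale_right_distrib ac_simps)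
  have "inj \<psi>"
  proof (rule injI)
    fix p q assume eq: "\<psi> p = \<psi> q"
    obtain x y z s x' y' z' s' where pq: "p = ((x, y, z), s)" "q = ((x', y', z'), s')"
      by (metis prod.exhaust)
    have F0: "lift_h y s + lift_f z \<in> F 0" for y s z
      using F_add lift_h_F0 F_mono[OF _ lift_f(1)] by simp
    have "symbol (-1) (\<psi> ((x, y, z), s)) = ((x, 0, 0), 0)" for x y z s
      using symbol_add[OF F_top F_top] symbol_eq_0_iff[OF F_top, of "lift_h y s + lift_f z"] F0
      by (simp add: \<psi> symbol_E)
    from this[of x y z s] this[of x' y' z' s'] have x: "x = x'"
      using eq by (simp add: pq)
    then have eq': "lift_h y s + lift_f z = lift_h y' s' + lift_f z'"
      using eq by (simp add: pq \<psi>)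
    have "symbol 0 (lift_h y s + lift_f z) = ((0, y, 0), s)" for y s z
      using symbol_add[OF lift_h_F0, of "lift_f z" y s] symbol_eq_0_iff[of "lift_f z" 0]
        F_mono[OF _ lift_f(1), of 0] lift_f(1) by (simp add: lift_h)
    from this[of y s z] this[of y' s' z'] have y: "y = y'" "s = s'"
      using eq' by simp_all
    then have "lift_f z = lift_f z'"
      using eq' by simp
    then have "z = z'"
      by (metis lift_f(2) prod.inject)
    then show "p = q"
      using x y pq by simp
  qed
  have "surj \<psi>"
    unfolding surj_def
  proof
    fix u
    obtain a where "symbol (-1) u = ((a, 0, 0), 0)"
      by (rule symbol_top)
    then have u: "u + E a \<in> F 0"
      using symbol_eqD[OF F_top F_top, of u "E a"] symbol_E by simp
    then obtain b s where bs: "symbol 0 (u + E a) = ((0, b, 0), s)"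
      by (rule symbol_F0)
    then have u': "(u + E a) + lift_h b s \<in> F 1"
      using symbol_eqD[OF u lift_h_F0] lift_h(2) by simp
    then obtain c where "symbol 1 ((u + E a) + lift_h b s) = ((0, 0, c), 0)"
      by (rule symbol_F1)
    then have "\<psi> ((a, b, c), s) = E a + (lift_h b s + ((u + E a) + lift_h b s))"
      using eq_lift_f[OF u'] by (simp add: \<psi>)
    also have "\<dots> = u"
      by (simp add: ac_simps L_add_cancel L_add_self)
    finally show "\<exists>p. u = \<psi> p"
      by metis
  qed
  have \<psi>_bracket: "\<psi> (deformed_bracket scale D \<mu> \<xi> \<alpha> \<gamma> p q) = brL (\<psi> p) (\<psi> q)" for p q
  proof -
    obtain x y z s x' y' z' s' where "p = ((x, y, z), s)" "q = ((x', y', z'), s')"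
      by (metis prod.exhaust)
    then show ?thesis
      by (simp add: \<psi>_def br_linear brackets E.add E.scale H_linear lift_f_linear
          L.scale_right_distrib ac_simps)
  qed
  have iso: "lie_isomorphism (SAD_scale scale) (deformed_bracket scale D \<mu> \<xi> \<alpha> \<gamma>) scaleL brL \<psi>"
    using \<psi>_linear \<open>inj \<psi>\<close> \<open>surj \<psi>\<close> \<psi>_bracket by (auto simp: lie_isomorphism_def bij_def)
  interpret B: lie_algebra "SAD_scale scale" "deformed_bracket scale D \<mu> \<xi> \<alpha> \<gamma>"
    using L.lie_algebra_axioms iso by (rule lie_algebra_transport)
  have "\<alpha> 0 0 = 0"
    using EH[of 0 0] H0 by (simp add: br_zero E.zero lift_f_eq_0)
  then have "deformed_SAD scale D \<mu> \<xi> \<alpha> \<gamma>"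
    by unfold_locales
  then show ?thesis
    using iso by blast
qed

end

section \<open>The classification\<close>

theorem proposition4p5:
  fixes scale :: "'k::field \<Rightarrow> 'a::comm_ring_1 \<Rightarrow> 'a"
    and D :: "'a \<Rightarrow> 'a"
    and scaleL :: "'k \<Rightarrow> 'l::ab_group_add \<Rightarrow> 'l"
    and brL :: "'l \<Rightarrow> 'l \<Rightarrow> 'l"
    and F :: "int \<Rightarrow> 'l set"
  assumes "CHAR('k) = 2"
    and "comm_algebra scale"
    and "derivation scale D"
    and "\<exists>a. D a \<noteq> 0"
    and "filtered_deformation scaleL brL F (SAD_graded scale D)"
  shows "\<exists>(v::'a) (w::'a) (\<xi>::'a \<Rightarrow> 'k) (br :: ('k, 'a) SAD \<Rightarrow> ('k, 'a) SAD \<Rightarrow> ('k, 'a) SAD).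
    D v = 0 \<and>
    \<xi> \<in> Xi_D_0 scale D \<and>
    (\<forall>a b c. (scale (\<xi> (a * b)) c + scale (\<xi> (c * a)) b + scale (\<xi> (b * c)) a) * w = 0) \<and>
    lie_algebra (SAD_scale scale) br \<and>
    (\<forall>a b.
      br (tens scale S_e a) (tens scale S_e b) = SAD_scale scale (\<xi> (a * b)) D_elt \<and>
      br (tens scale S_e a) (tens scale S_h b) =
        tens scale S_e (a * b) + tens scale S_f (a * b * v + scale (\<xi> b) (D a)) \<and>
      br (tens scale S_e a) (tens scale S_f b) = tens scale S_h (a * b) \<and>
      br (tens scale S_h a) (tens scale S_h b) = 0 \<and>
      br (tens scale S_h a) (tens scale S_f b) = tens scale S_f (a * b) \<and>
      br (tens scale S_f a) (tens scale S_f b) = 0 \<and>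
      br (tens scale S_e a) D_elt = tens scale S_e (D a) + tens scale S_f (a * w) \<and>
      br (tens scale S_h a) D_elt = tens scale S_h (D a) \<and>
      br (tens scale S_f a) D_elt = tens scale S_f (D a)) \<and>
    (\<exists>\<phi>. lie_isomorphism scaleL brL (SAD_scale scale) br \<phi>)"
proof -
  interpret derivation scale D by fact
  obtain symbol where "SAD_deformation scale D scaleL brL F symbol"
    using symbol_map_exists[OF assms(1,3,5)] by blast
  then interpret SAD_deformation scale D scaleL brL F symbol .
  obtain h0 where "h0 \<in> F 0" "symbol 0 h0 = ((0, 1, 0), 0)"
    using symbol_surj[of "((0, 1, 0), 0)" 0] by (auto simp: SAD_piece_iff)
  then interpret SAD_deformation_torus scale D scaleL brL F symbol h0
    by unfold_locales
  obtain \<mu> \<xi>2 \<alpha> \<gamma> \<psi> where "deformed_SAD scale D \<mu> \<xi>2 \<alpha> \<gamma>"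
    and \<psi>: "lie_isomorphism (SAD_scale scale) (deformed_bracket scale D \<mu> \<xi>2 \<alpha> \<gamma>) scaleL brL \<psi>"
    using normal_form by blast
  then interpret M: deformed_SAD scale D \<mu> \<xi>2 \<alpha> \<gamma> by simp
  define \<alpha>' where "\<alpha>' = (\<lambda>a b. \<alpha> a b + b * \<mu> a 1 + \<mu> (a * b) 1)"
  define \<gamma>' where "\<gamma>' = (\<lambda>a. \<gamma> a + D (\<mu> a 1) + \<mu> (D a) 1)"
  define br where "br = deformed_bracket scale D (\<lambda>a b. 0) \<xi>2 \<alpha>' \<gamma>'"
  have shear: "lie_isomorphism (SAD_scale scale) br (SAD_scale scale) M.br M.shear"
    unfolding br_def \<alpha>'_def \<gamma>'_def by (rule M.shear_isomorphism)
  have lie: "lie_algebra (SAD_scale scale) br"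
    using M.B.lie_algebra_axioms shear by (rule lie_algebra_transport)
  interpret N: deformed_SAD scale D "\<lambda>a b. 0" \<xi>2 \<alpha>' \<gamma>'
  proof -
    interpret B: lie_algebra "SAD_scale scale" "deformed_bracket scale D (\<lambda>a b. 0) \<xi>2 \<alpha>' \<gamma>'"
      using lie unfolding br_def .
    show "deformed_SAD scale D (\<lambda>a b. 0) \<xi>2 \<alpha>' \<gamma>'"
      by unfold_locales (simp add: \<alpha>'_def M.zeros M.\<mu>_\<xi>_zero)
  qed
  define v w \<xi> where "v = \<alpha>' 1 1" and "w = \<gamma>' 1" and "\<xi> = (\<lambda>a. \<xi>2 a 1)"
  have \<alpha>': "\<alpha>' a b = a * b * v + scale (\<xi> b) (D a)" and \<gamma>': "\<gamma>' a = a * w"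
    and \<xi>2: "\<xi>2 a b = \<xi> (a * b)" for a b
    using N.structure_maps_when_\<mu>_zero(1)[of a b] N.structure_maps_when_\<mu>_zero(2)[of a] N.\<xi>_mult[of a b]
    by (simp_all add: v_def w_def \<xi>_def)
  have "D v = 0" "\<xi> \<in> Xi_D_0 scale D"
    and "(scale (\<xi> (a * b)) c + scale (\<xi> (c * a)) b + scale (\<xi> (b * c)) a) * w = 0" for a b c
    using N.structure_maps_when_\<mu>_zero(3-5) by (simp_all add: v_def w_def \<xi>_def)
  moreover have "lie_isomorphism scaleL brL (SAD_scale scale) br (inv (\<psi> \<circ> M.shear))"
    by (intro lie_isomorphism_inverse lie_isomorphism_compose[OF shear \<psi>])
  moreover note tens_simps = tens_def S_e_def S_h_def S_f_def D_elt_def zero_prod_def br_def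
    M.zeros N.zeros \<xi>2 \<alpha>' \<gamma>'
  have "br (tens scale S_e a) (tens scale S_e b) = SAD_scale scale (\<xi> (a * b)) D_elt"
    "br (tens scale S_e a) (tens scale S_h b) =
        tens scale S_e (a * b) + tens scale S_f (a * b * v + scale (\<xi> b) (D a))"
    "br (tens scale S_e a) (tens scale S_f b) = tens scale S_h (a * b)"
    "br (tens scale S_h a) (tens scale S_h b) = 0"
    "br (tens scale S_h a) (tens scale S_f b) = tens scale S_f (a * b)"
    "br (tens scale S_f a) (tens scale S_f b) = 0"
    "br (tens scale S_e a) D_elt = tens scale S_e (D a) + tens scale S_f (a * w)"
    "br (tens scale S_h a) D_elt = tens scale S_h (D a)"
    "br (tens scale S_f a) D_elt = tens scale S_f (D a)" for a b
    using N.\<mu>_\<xi>_zero(2)[of 0] by (simp_all add: tens_simps)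
  ultimately show ?thesis
    using lie
    by (intro exI[of _ v] exI[of _ w] exI[of _ \<xi>] exI[of _ br] conjI allI) blast+
qed

end
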